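(* Consider a blocked main effect plan with factors $A_1,\dots,A_{m-1}$, block factor $A_m$ and general effect $A_{m+1}$ ($m\ge 3$), on $n$ runs. Fix a factor $A_i$. (a) A necessary and sufficient condition for $SS_{i;all}=SS_{i;m+1}$ is that the incidence matrices satisfy the proportional frequency condition $$N_{ij}=\frac{1}{n}\, r_i r_j' \quad\text{for every } j\neq i .$$ (b) A necessary and sufficient condition for $SS_{i;all}=SS_{i;m}$ is that $$N_{ij}=N_{im}(R_m)^{-1}N_{jm}',\qquad j\neq i,\ 1\le i,j\le m-1 .$$
   Context: Model: $\mathbf{Y}=\mathbf{X}\beta$ (in expectation) with $\mathbf{X}=[X_1\,|\,\cdots\,|\,X_{m+1}]$ and $\beta=((\alpha^1)',\dots,(\alpha^{m+1})')'$. For $1\le i\le m$, $X_i$ is the $n\times a_i$ design matrix of $A_i$ (where $a_i$ is the number of levels of $A_i$): its $(u,t)$ entry is $1$ if in run $u$ the factor $A_i$ is at level $t$, and $0$ otherwise. The matrix $X_{m+1}=\mathbf{1}_n$ is the all-one column; $\alpha^i$ is the vector of unknown effects of $A_i$, so $\alpha^m$ is the vector of block effects and $\alpha^{m+1}$ is the general effect. Each level of each factor occurs in at least one run. $N_{ij}=X_i'X_j$ is the $A_i$-versus-$A_j$ incidence matrix (its $(p,q)$ entry is the number of runs with $A_i$ at level $p$ and $A_j$ at level $q$). $r_i=X_i'\mathbf{1}_n$ is the vector of replications of $A_i$. $R_i=N_{ii}$ is the diagonal matrix of these replications. In (a), the indices $i,j$ range over $1,\dots,m$ (including the block factor). For $T\subset\{1,\dots,m+1\}$,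 $X_T$ is the matrix obtained by juxtaposing the $X_t$, $t\in T$, and $P_T$ is the orthogonal projection onto the column space of $X_T$. For $i\notin T$, the sum of squares for $A_i$ adjusted for the factors in $T$ is the quadratic form in $Y$ $$SS_{i;T}=Q_{i;T}'(C_{ii;T})^-Q_{i;T},\quad Q_{i;T}=X_i'(I-P_T)Y,\quad C_{ii;T}=X_i'(I-P_T)X_i,$$ where $B^-$ denotes a g-inverse of $B$; equivalently $SS_{i;T}=Y'P_UY$, where $P_U$ is the orthogonal projection onto the column space of $U=(I-P_T)X_i$. Write $SS_{i;j}=SS_{i;\{j\}}$. In particular, $SS_{i;m+1}$ is the so-called unadjusted sum of squares and $SS_{i;m}$ is the sum of squares adjusted for blocks only. Finally $SS_{i;all}=SS_{i;T}$ with $T=\{1,\dots,m+1\}\setminus\{i\}$. Equality of sums of squares means equality as quadratic forms, i.e. for all $Y\in\mathbb{R}^n$. *)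

theory Defs
  imports
    "Jordan_Normal_Form.Gauss_Jordan_Elimination"
    "Jordan_Normal_Form.VS_Connect"
begin

text \<open>
  A plan with factors \<open>1, \<dots>, nfac\<close> on \<open>nruns\<close> runs; the last factor \<open>nfac\<close> is the block factor.
  Runs are numbered \<open>0, \<dots>, nruns - 1\<close> and the levels of factor \<open>i\<close> are \<open>0, \<dots>, nlev i - 1\<close>;
  \<open>lev i u\<close> is the level of factor \<open>i\<close> in run \<open>u\<close>.  The index \<open>nfac + 1\<close> is reserved for the
  general effect.
\<close>

record plan =
  nruns :: nat
  nfac :: nat
  nlev :: "nat \<Rightarrow> nat"
  lev :: "nat \<Rightarrow> nat \<Rightarrow> nat"

definition blocked_main_effect_plan :: "plan \<Rightarrow> bool" where
  "blocked_main_effect_plan D \<longleftrightarrow>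
     0 < nruns D \<and> 3 \<le> nfac D \<and>
     (\<forall>i\<in>{1..nfac D}.
        (\<forall>u<nruns D. lev D i u < nlev D i) \<and>
        (\<forall>t<nlev D i. \<exists>u<nruns D. lev D i u = t))"

definition design_mat :: "plan \<Rightarrow> nat \<Rightarrow> real mat" where
  "design_mat D i =
     (if i = nfac D + 1 then mat (nruns D) 1 (\<lambda>_. 1)
      else mat (nruns D) (nlev D i) (\<lambda>(u, t). if lev D i u = t then 1 else 0))"

definition incidence :: "plan \<Rightarrow> nat \<Rightarrow> nat \<Rightarrow> real mat" where
  "incidence D i j = (design_mat D i)\<^sup>T * design_mat D j"

text \<open>The replication vector, as a matrix with a single column.\<close>

definition replication :: "plan \<Rightarrow> nat \<Rightarrow> real mat" where
  "replication D i = (design_mat D i)\<^sup>T * mat (nruns D) 1 (\<lambda>_. 1)"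

definition replication_mat :: "plan \<Rightarrow> nat \<Rightarrow> real mat" where
  "replication_mat D i = incidence D i i"

text \<open>The matrices \<open>X\<^sub>t\<close>, \<open>t \<in> T\<close> (for finite \<open>T\<close>), juxtaposed in increasing order of \<open>t\<close>.\<close>

definition juxtaposed :: "plan \<Rightarrow> nat set \<Rightarrow> real mat" where
  "juxtaposed D T =
     mat_of_cols (nruns D) (concat (map (\<lambda>t. cols (design_mat D t)) (sorted_list_of_set T)))"

definition is_col_projection :: "real mat \<Rightarrow> real mat \<Rightarrow> bool" where
  "is_col_projection M P \<longleftrightarrow>
     P \<in> carrier_mat (dim_row M) (dim_row M) \<and>
     (\<forall>v\<in>carrier_vec (dim_row M).
        P *\<^sub>v v \<in> vec_space.col_space (dim_row M) M \<and>
        (\<forall>w\<in>vec_space.col_space (dim_row M) M. (v - P *\<^sub>v v) \<bullet> w = 0))"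

definition col_projection :: "real mat \<Rightarrow> real mat" where
  "col_projection M = (THE P. is_col_projection M P)"

definition is_ginverse :: "real mat \<Rightarrow> real mat \<Rightarrow> bool" where
  "is_ginverse B G \<longleftrightarrow> G \<in> carrier_mat (dim_col B) (dim_row B) \<and> B * G * B = B"

text \<open>Some g-inverse; the sums of squares below do not depend on which one is chosen.\<close>

definition ginverse :: "real mat \<Rightarrow> real mat" where
  "ginverse B = (SOME G. is_ginverse B G)"

definition residual_mat :: "plan \<Rightarrow> nat set \<Rightarrow> real mat" where
  "residual_mat D T = 1\<^sub>m (nruns D) - col_projection (juxtaposed D T)"

definition Q_adj :: "plan \<Rightarrow> nat \<Rightarrow> nat set \<Rightarrow> real vec \<Rightarrow> real vec" where
  "Q_adj D i T Y = ((design_mat D i)\<^sup>T * residual_mat D T) *\<^sub>v Y"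

definition C_adj :: "plan \<Rightarrow> nat \<Rightarrow> nat set \<Rightarrow> real mat" where
  "C_adj D i T = (design_mat D i)\<^sup>T * residual_mat D T * design_mat D i"

definition SS :: "plan \<Rightarrow> nat \<Rightarrow> nat set \<Rightarrow> real vec \<Rightarrow> real" where
  "SS D i T Y = Q_adj D i T Y \<bullet> (ginverse (C_adj D i T) *\<^sub>v Q_adj D i T Y)"

definition SS_all :: "plan \<Rightarrow> nat \<Rightarrow> real vec \<Rightarrow> real" where
  "SS_all D i = SS D i ({1..nfac D + 1} - {i})"

end

theory Submission
  imports Defs
begin

text \<open>
  Both parts compare adjustment for all other factors \<open>T\<close> with adjustment for a single
  \<open>t \<in> T\<close>.  A sum of squares adjusted for \<open>T\<close> vanishes on the column space of \<open>X\<^sub>T\<close>, and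
  \<open>SS\<^bsub>i;t\<^esub>(Y) = 0\<close> forces \<open>Q\<^bsub>i;t\<^esub> = 0\<close>.  So equality of the two forms gives
  \<open>X\<^sub>i\<^sup>T (1 - P\<^sub>t) X\<^sub>j = 0\<close> for every \<open>j \<in> T\<close>, and conversely these equations make \<open>Q\<close> and \<open>C\<close>
  agree for \<open>T\<close> and \<open>t\<close>.  The two frequency conditions arise by inserting
  \<open>P\<^bsub>m+1\<^esub> = 1 1\<^sup>T / n\<close> and \<open>P\<^sub>m = X\<^sub>m R\<^sub>m\<^sup>-\<^sup>1 X\<^sub>m\<^sup>T\<close>; the remaining equation, for \<open>j = m + 1\<close> in the
  second case, holds because the all-one vector lies in the column space of \<open>X\<^sub>m\<close>.
\<close>

section \<open>Existence of least-squares inverses and g-inverses\<close>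

text \<open>Gram-Schmidt by induction on the number of columns: \<open>M K\<close> is the orthogonal
  projection onto their span, and a new column adds the rank-one projection onto its residual.
  Entries are given by functions and sums, so that appending a column needs no change of matrix
  dimensions.\<close>

lemma ex_least_squares_inverse:
  fixes M :: "nat \<Rightarrow> nat \<Rightarrow> real"
  shows "\<exists>K. (\<forall>i<n. \<forall>j<n. (\<Sum>l<k. M i l * K l j) = (\<Sum>l<k. M j l * K l i)) \<and>
             (\<forall>i<n. \<forall>l<k. (\<Sum>j<n. (\<Sum>h<k. M i h * K h j) * M j l) = M i l)"
proof (induction k)
  case 0
  then show ?case by simp
next
  case (Suc k)
  then obtain K where
      "\<forall>i<n. \<forall>j<n. (\<Sum>l<k. M i l * K l j) = (\<Sum>l<k. M j l * K l i)"
    and "\<forall>i<n. \<forall>l<k. (\<Sum>j<n. (\<Sum>h<k. M i h * K h j) * M j l) = M i l"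
    by blast
  moreover define p where "p i j = (\<Sum>l<k. M i l * K l j)" for i j
  ultimately have sym: "\<And>i j. i < n \<Longrightarrow> j < n \<Longrightarrow> p i j = p j i"
    and fixed: "\<And>i l. i < n \<Longrightarrow> l < k \<Longrightarrow> (\<Sum>j<n. p i j * M j l) = M i l"
    by auto
  \<comment> \<open>\<open>w\<close> is the residual of column \<open>k\<close> after projection
    onto the first \<open>k\<close> columns, \<open>c\<close> holds the coefficients of that
    projection, and \<open>s\<close> is the squared norm of \<open>w\<close>.\<close>
  define c where "c h = (\<Sum>j<n. K h j * M j k)" for h
  define w where "w i = M i k - (\<Sum>j<n. p i j * M j k)" for i
  define s where "s = (\<Sum>j<n. w j * w j)"
  have w_alt: "w i = M i k - (\<Sum>h<k. M i h * c h)" for i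
  proof -
    have "(\<Sum>j<n. p i j * M j k) = (\<Sum>j<n. \<Sum>h<k. M i h * (K h j * M j k))"
      by (simp add: p_def sum_distrib_right mult.assoc)
    also have "\<dots> = (\<Sum>h<k. M i h * c h)"
      unfolding c_def sum_distrib_left by (rule sum.swap)
    finally show ?thesis by (simp add: w_def)
  qed
  \<comment> \<open>Symmetry of \<open>p\<close> lets it act on column \<open>l\<close> instead of
    column \<open>k\<close>, and there \<open>fixed\<close> applies.\<close>
  have w_orth: "(\<Sum>j<n. w j * M j l) = 0" if "l < k" for l
  proof -
    have "(\<Sum>j<n. (\<Sum>h<n. p j h * M h k) * M j l) = (\<Sum>j<n. \<Sum>h<n. M h k * (p h j * M j l))"
      by (auto simp: sum_distrib_right sym intro!: sum.cong)
    also have "\<dots> = (\<Sum>h<n. \<Sum>j<n. M h k * (p h j * M j l))"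
      by (rule sum.swap)
    also have "\<dots> = (\<Sum>h<n. M h k * M h l)"
      by (auto simp: sum_distrib_left[symmetric] fixed that)
    finally show ?thesis
      by (simp add: w_def left_diff_distrib sum_subtractf mult.commute[of "M _ k"])
  qed
  \<comment> \<open>Column \<open>k\<close> minus \<open>w\<close> is a combination of the first
    \<open>k\<close> columns, hence orthogonal to \<open>w\<close>.\<close>
  have w_last: "(\<Sum>j<n. w j * M j k) = s"
  proof -
    have "(\<Sum>j<n. w j * (\<Sum>h<k. M j h * c h)) = (\<Sum>j<n. \<Sum>h<k. c h * (w j * M j h))"
      by (simp add: sum_distrib_left mult_ac)
    also have "\<dots> = (\<Sum>h<k. \<Sum>j<n. c h * (w j * M j h))"
      by (rule sum.swap)
    also have "\<dots> = 0"
      by (simp add: sum_distrib_left[symmetric] w_orth)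
    finally have "(\<Sum>j<n. w j * (M j k - w j)) = 0"
      by (simp add: w_alt)
    then show ?thesis
      by (simp add: s_def right_diff_distrib sum_subtractf)
  qed
  \<comment> \<open>If the new column already lies in the span, then \<open>s = 0\<close> and every \<open>w j / s\<close> is \<open>0\<close>.\<close>
  define K' where "K' l j = (if l = k then w j / s else K l j - c l * (w j / s))" for l j
  have p': "(\<Sum>l<Suc k. M i l * K' l j) = p i j + w i * (w j / s)" for i j
  proof -
    have "(\<Sum>l<k. M i l * K' l j) = (\<Sum>l<k. M i l * K l j - M i l * c l * (w j / s))"
      by (intro sum.cong) (auto simp: K'_def algebra_simps)
    also have "\<dots> = p i j - (\<Sum>l<k. M i l * c l) * (w j / s)"
      by (simp only: sum_subtractf p_def sum_distrib_right)
    also have "\<dots> = p i j - (M i k - w i) * (w j / s)"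
      by (simp only: w_alt[of i] diff_diff_eq2 add_diff_cancel_left')
    finally show ?thesis
      by (simp only: sum.lessThan_Suc left_diff_distrib) (simp add: K'_def)
  qed
  have w0: "w i = 0" if "s = 0" "i < n" for i
    using that by (auto simp: s_def sum_nonneg_eq_0_iff)
  have "(\<Sum>j<n. (p i j + w i * (w j / s)) * M j l) = M i l" if "i < n" "l < Suc k" for i l
  proof -
    have "(\<Sum>j<n. (p i j + w i * (w j / s)) * M j l)
        = (\<Sum>j<n. p i j * M j l) + w i / s * (\<Sum>j<n. w j * M j l)"
      unfolding sum_distrib_left sum.distrib[symmetric] by (intro sum.cong refl) (simp only: distrib_right times_divide_eq_left times_divide_eq_right mult.assoc)
    also have "\<dots> = M i l"
    proof (cases "l = k")
      case True
      have "w i / s * s = w i" using w0[OF _ \<open>i < n\<close>] by (cases "s = 0") simp_all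
      then show ?thesis unfolding True w_last by (simp only: w_def[of i])
    next
      case False
      then show ?thesis using that by (simp add: fixed w_orth)
    qed
    finally show ?thesis .
  qed
  then show ?case
    by (intro exI[of _ K']) (simp only: p', simp add: sym)
qed

lemma ex_least_squares_inverse_mat:
  fixes M :: "real mat"
  assumes M: "M \<in> carrier_mat n k"
  obtains K where "K \<in> carrier_mat k n" "(M * K)\<^sup>T = M * K" "M * K * M = M"
proof -
  obtain K where
      sym: "\<forall>i<n. \<forall>j<n. (\<Sum>l<k. M $$ (i, l) * K l j) = (\<Sum>l<k. M $$ (j, l) * K l i)"
    and fixed: "\<forall>i<n. \<forall>l<k. (\<Sum>j<n. (\<Sum>h<k. M $$ (i, h) * K h j) * M $$ (j, l)) = M $$ (i, l)"
    using ex_least_squares_inverse[where n = n and k = k and M = "\<lambda>i l. M $$ (i, l)"] by blast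
  let ?K = "mat k n (\<lambda>(l, j). K l j)"
  have MK: "(M * ?K) $$ (i, j) = (\<Sum>l<k. M $$ (i, l) * K l j)" if "i < n" "j < n" for i j
    using that M by (simp add: scalar_prod_def atLeast0LessThan)
  have dim: "M * ?K \<in> carrier_mat n n" using M by auto
  have "(M * ?K)\<^sup>T = M * ?K"
    using dim sym by (intro eq_matI) (auto simp: MK simp del: index_mult_mat(1))
  moreover have "(M * ?K * M) $$ (i, l) = M $$ (i, l)" if "i < n" "l < k" for i l
  proof -
    have "(M * ?K * M) $$ (i, l) = (\<Sum>j<n. (M * ?K) $$ (i, j) * M $$ (j, l))"
      using that dim M
      by (subst index_mult_mat(1)) (auto simp: scalar_prod_def atLeast0LessThan simp del: index_mult_mat(1))
    then show ?thesis using fixed that by (simp add: MK del: index_mult_mat(1))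
  qed
  then have "M * ?K * M = M"
    using M by (intro eq_matI) (auto simp del: index_mult_mat(1))
  ultimately show ?thesis using that[of ?K] by simp
qed

text \<open>A least-squares inverse is in particular a g-inverse, so the choice in
  \<open>ginverse\<close> is made from a nonempty set.\<close>

lemma is_ginverse_ginverse: "is_ginverse B (ginverse B)"
proof -
  have "B \<in> carrier_mat (dim_row B) (dim_col B)" by simp
  then obtain K where "K \<in> carrier_mat (dim_col B) (dim_row B)" "B * K * B = B"
    by (rule ex_least_squares_inverse_mat)
  then have "is_ginverse B K" by (simp add: is_ginverse_def)
  then show ?thesis unfolding ginverse_def by (rule someI)
qed

section \<open>Orthogonal projections onto column spaces\<close>

lemma real_scalar_prod_self_eq_0:
  fixes v :: "real vec"
  assumes "v \<in> carrier_vec n" "v \<bullet> v = 0"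
  shows "v = 0\<^sub>v n"
proof -
  have "\<forall>i\<in>{0..<n}. v $ i * v $ i = 0"
    using assms by (subst sum_nonneg_eq_0_iff[symmetric]) (auto simp: scalar_prod_def)
  then show ?thesis using assms by (intro eq_vecI) auto
qed

text \<open>Serves two purposes: with the identity for \<open>M\<close> it gives extensionality of
  matrices, and for juxtaposed matrices it lets an equation be split factor by factor.\<close>

lemma mat_eq_iff_cols:
  fixes A B :: "real mat"
  assumes "A \<in> carrier_mat a n" "B \<in> carrier_mat a n" "M \<in> carrier_mat n k"
  shows "A * M = B * M \<longleftrightarrow> (\<forall>v\<in>set (cols M). A *\<^sub>v v = B *\<^sub>v v)"
proof
  assume eq: "A * M = B * M"
  have "A *\<^sub>v col M j = B *\<^sub>v col M j" if "j < k" for j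
    using eq col_mult2[OF assms(1,3) that] col_mult2[OF assms(2,3) that] by simp
  then show "\<forall>v\<in>set (cols M). A *\<^sub>v v = B *\<^sub>v v"
    using assms by (auto simp: cols_def)
next
  assume "\<forall>v\<in>set (cols M). A *\<^sub>v v = B *\<^sub>v v"
  then have eq: "A *\<^sub>v col M j = B *\<^sub>v col M j" if "j < k" for j
    using assms that by (auto simp: cols_def)
  show "A * M = B * M"
  proof (rule mat_col_eqI)
    fix j assume "j < dim_col (B * M)"
    then have j: "j < k" using assms by simp
    show "col (A * M) j = col (B * M) j"
      unfolding col_mult2[OF assms(1,3) j] col_mult2[OF assms(2,3) j] using j by (rule eq)
  qed (use assms in auto)
qed

text \<open>The normal equations, obtained by transposing \<open>M * K * M = M\<close>: the residual
  of the projection \<open>M * K\<close> is orthogonal to every column of \<open>M\<close>.\<close>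

lemma least_squares_normal:
  fixes M :: "real mat"
  assumes M: "M \<in> carrier_mat n k" and K: "K \<in> carrier_mat k n"
    and sym: "(M * K)\<^sup>T = M * K" and fixed: "M * K * M = M"
  shows "M\<^sup>T * (M * K) = M\<^sup>T"
proof -
  have "M\<^sup>T = (M * K * M)\<^sup>T" by (simp only: fixed)
  also have "\<dots> = M\<^sup>T * (M * K)\<^sup>T"
    by (rule transpose_mult[of _ n n _ k]) (use M K in auto)
  finally show ?thesis using sym by simp
qed

lemma mem_col_space_iff:
  assumes "M \<in> carrier_mat n k"
  shows "y \<in> vec_space.col_space n M \<longleftrightarrow> (\<exists>x\<in>carrier_vec k. y = M *\<^sub>v x)"
  using assms by (subst vec_space.col_space_eq[OF assms]) auto

text \<open>The normal equations make \<open>M * K\<close> a projection of the required kind. For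
  uniqueness, the residual of any competitor \<open>P\<close> is orthogonal to the columns, so
  \<open>M * K\<close> annihilates it, while \<open>M * K\<close> fixes
  \<open>P *\<^sub>v v\<close>.\<close>

lemma col_projection_eq:
  assumes M: "M \<in> carrier_mat n k" and K: "K \<in> carrier_mat k n"
    and sym: "(M * K)\<^sup>T = M * K" and fixed: "M * K * M = M"
  shows "col_projection M = M * K"
  unfolding col_projection_def
proof (rule the_equality)
  have [simp]: "dim_row M = n" using M by simp
  have MK: "M * K \<in> carrier_mat n n" and MT: "M\<^sup>T \<in> carrier_mat k n" using M K by auto
  note normal = least_squares_normal[OF assms]
  have "(v - M * K *\<^sub>v v) \<bullet> (M *\<^sub>v x) = 0" if v: "v \<in> carrier_vec n" and x: "x \<in> carrier_vec k" for v x
  proof -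
    have "M\<^sup>T *\<^sub>v (v - M * K *\<^sub>v v) = M\<^sup>T *\<^sub>v v - M\<^sup>T * (M * K) *\<^sub>v v"
      by (simp only: mult_minus_distrib_mat_vec[OF MT v mult_mat_vec_carrier[OF MK v]]
          assoc_mult_mat_vec[OF MT MK v])
    also have "\<dots> = 0\<^sub>v k" using M v by (simp only: normal) auto
    finally show ?thesis
      using MK v x transpose_vec_mult_scalar[OF M x, of "v - M * K *\<^sub>v v"]
      by (simp del: assoc_mult_mat_vec)
  qed
  then show "is_col_projection M (M * K)"
    using M K by (auto simp: is_col_projection_def mem_col_space_iff[OF M] intro!: bexI[of _ "K *\<^sub>v _"])
  fix P assume "is_col_projection M P"
  then have P: "P \<in> carrier_mat n n"
    and Pv: "\<And>v. v \<in> carrier_vec n \<Longrightarrow> \<exists>x\<in>carrier_vec k. P *\<^sub>v v = M *\<^sub>v x"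
    and orth: "\<And>v x. v \<in> carrier_vec n \<Longrightarrow> x \<in> carrier_vec k \<Longrightarrow> (v - P *\<^sub>v v) \<bullet> (M *\<^sub>v x) = 0"
    using mem_col_space_iff[OF M] by (auto simp: is_col_projection_def)
  have "P *\<^sub>v v = M * K *\<^sub>v v" if v: "v \<in> carrier_vec n" for v
  proof -
    let ?r = "v - P *\<^sub>v v"
    have r: "?r \<in> carrier_vec n" using P v by auto
    have "M * K *\<^sub>v ?r = K\<^sup>T *\<^sub>v (M\<^sup>T *\<^sub>v ?r)"
      using M K r by (subst sym[symmetric], subst transpose_mult[OF M K]) auto
    \<comment> \<open>The squared norm of this vector is the product of \<open>?r\<close> with an
      element of the column space.\<close>
    moreover have "M\<^sup>T *\<^sub>v ?r = 0\<^sub>v k"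
    proof (rule real_scalar_prod_self_eq_0)
      show "M\<^sup>T *\<^sub>v ?r \<in> carrier_vec k" using M r by auto
      then show "(M\<^sup>T *\<^sub>v ?r) \<bullet> (M\<^sup>T *\<^sub>v ?r) = 0"
        using transpose_vec_mult_scalar[OF M _ r] orth[OF v] by simp
    qed
    ultimately have "M * K *\<^sub>v ?r = 0\<^sub>v n" using K by auto
    moreover obtain x where x: "x \<in> carrier_vec k" "P *\<^sub>v v = M *\<^sub>v x" using Pv[OF v] by auto
    moreover have "M * K *\<^sub>v (M *\<^sub>v x) = M *\<^sub>v x"
      using x(1) M K fixed assoc_mult_mat_vec[of "M * K" n n M k x] by auto
    moreover have "M * K *\<^sub>v ?r = M * K *\<^sub>v v - M * K *\<^sub>v (P *\<^sub>v v)"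
      using MK P v by (intro mult_minus_distrib_mat_vec[of _ n n]) auto
    ultimately have "M * K *\<^sub>v v - P *\<^sub>v v = 0\<^sub>v n" by simp
    then show ?thesis
      using M K P v by (intro eq_vecI) (auto simp: vec_eq_iff simp del: index_mult_mat_vec assoc_mult_mat_vec)
  qed
  then show "P = M * K"
    using mat_eq_iff_cols[OF P MK one_carrier_mat] cols_dim[of "1\<^sub>m n :: real mat"]
      right_mult_one_mat[OF P] right_mult_one_mat[OF MK] by auto
qed

lemma col_projectionE:
  assumes M: "M \<in> carrier_mat n k"
  obtains K where "K \<in> carrier_mat k n" "col_projection M = M * K"
    "(M * K)\<^sup>T = M * K" "M * K * M = M"
  using ex_least_squares_inverse_mat[OF M] col_projection_eq[OF M] by metis

text \<open>With an invertible Gram matrix, \<open>B * M\<^sup>T\<close> is a least-squares inverse.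
  Its symmetry condition needs \<open>B\<close> symmetric, which holds because
  \<open>B\<^sup>T\<close> also inverts the symmetric Gram matrix.\<close>

lemma col_projection_gram_inverse:
  assumes M: "M \<in> carrier_mat n k" and B: "B \<in> carrier_mat k k"
    and inv: "M\<^sup>T * M * B = 1\<^sub>m k" "B * (M\<^sup>T * M) = 1\<^sub>m k"
  shows "col_projection M = M * B * M\<^sup>T"
proof -
  have G: "M\<^sup>T * M \<in> carrier_mat k k" using M by auto
  have "B\<^sup>T * (M\<^sup>T * M) = (M\<^sup>T * M * B)\<^sup>T"
    using M by (subst transpose_mult[OF G B], subst transpose_mult[of "M\<^sup>T" k n M k]) auto
  then have "B\<^sup>T * (M\<^sup>T * M) = 1\<^sub>m k" by (simp add: inv)
  then have "B\<^sup>T * (M\<^sup>T * M) * B = B" using B by auto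
  then have symB: "B\<^sup>T = B"
    using B G by (simp only: assoc_mult_mat[OF _ G B, of "B\<^sup>T" k] transpose_carrier_mat inv) simp
  have MBM: "M * B * M\<^sup>T = M * (B * M\<^sup>T)" using M B by auto
  have "(M * (B * M\<^sup>T))\<^sup>T = M * B\<^sup>T * M\<^sup>T"
    using M B by (simp add: transpose_mult[of M n k _ n] transpose_mult[of B k k _ n])
  moreover have "M * (B * M\<^sup>T) * M = M * (B * (M\<^sup>T * M))"
    using M B by (simp add: assoc_mult_mat[of _ n k _ n _ k] assoc_mult_mat[of _ k k _ n _ k])
  ultimately show ?thesis
    using M B symB by (subst MBM, intro col_projection_eq[OF M]) (auto simp: inv MBM)
qed

section \<open>Sums of squares as functions of the residual projection\<close>

text \<open>A sum of squares depends on the set of adjusting factors only through the residual projection \<open>E\<close>.\<close>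

definition ssq :: "real mat \<Rightarrow> real mat \<Rightarrow> real vec \<Rightarrow> real" where
  "ssq X E Y = (X\<^sup>T * E *\<^sub>v Y) \<bullet> (ginverse (X\<^sup>T * E * X) *\<^sub>v (X\<^sup>T * E *\<^sub>v Y))"

lemma SS_eq_ssq: "SS D i T Y = ssq (design_mat D i) (residual_mat D T) Y"
  by (simp add: SS_def ssq_def Q_adj_def C_adj_def)

text \<open>With \<open>U = E * X\<close> and \<open>C = U\<^sup>T * U\<close>, the normal equations
  give \<open>U\<^sup>T *\<^sub>v Y = C *\<^sub>v z\<close>. Then \<open>C * G * C = C\<close> turns
  the form into the squared norm of \<open>U *\<^sub>v z\<close>, whichever g-inverse
  \<open>G\<close> was chosen, and its vanishing forces \<open>C *\<^sub>v z = 0\<close>.\<close>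

lemma ssq_eq_0_imp:
  assumes X: "X \<in> carrier_mat n a" and E: "E \<in> carrier_mat n n" and Y: "Y \<in> carrier_vec n"
    and sym: "E\<^sup>T = E" and idem: "E * E = E" and zero: "ssq X E Y = 0"
  shows "X\<^sup>T * E *\<^sub>v Y = 0\<^sub>v a"
proof -
  define U where "U = E * X"
  have U: "U \<in> carrier_mat n a" using X E by (simp add: U_def)
  have UT: "U\<^sup>T = X\<^sup>T * E" using X E sym by (simp add: U_def transpose_mult)
  define C where "C = U\<^sup>T * U"
  have C: "C \<in> carrier_mat a a" using U by (simp add: C_def)
  have symC: "C\<^sup>T = C" using U by (simp add: C_def transpose_mult[of _ a n])
  have "X\<^sup>T * E * U = X\<^sup>T * (E * E) * X"
    using X E unfolding U_def by (simp add: assoc_mult_mat[of _ a n _ n _ a] assoc_mult_mat[of _ n n _ n _ a])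
  \<comment> \<open>Idempotence of \<open>E\<close> identifies the matrix inverted in
    \<open>ssq\<close> with the Gram matrix of \<open>U\<close>.\<close>
  then have UX: "U\<^sup>T * X = C" by (simp add: C_def UT idem)
  define G where "G = ginverse C"
  have G: "G \<in> carrier_mat a a" "C * G * C = C"
    using is_ginverse_ginverse[of C] C by (auto simp: G_def is_ginverse_def)
  obtain K where K: "K \<in> carrier_mat a n" and "(U * K)\<^sup>T = U * K" "U * K * U = U"
    using ex_least_squares_inverse_mat[OF U] .
  then have normal: "U\<^sup>T * (U * K) = U\<^sup>T"
    using least_squares_normal[OF U K] by simp
  define z where "z = K *\<^sub>v Y"
  have z: "z \<in> carrier_vec a" using K Y by (simp add: z_def)
  have "U\<^sup>T *\<^sub>v Y = U\<^sup>T * (U * K) *\<^sub>v Y" by (simp only: normal)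
  also have "\<dots> = U\<^sup>T * U *\<^sub>v z"
    using U K Y assoc_mult_mat_vec[of "U\<^sup>T" a n "U * K" n Y] by (simp add: z_def)
  finally have UY: "U\<^sup>T *\<^sub>v Y = C *\<^sub>v z" by (simp only: C_def)
  have GCz: "G *\<^sub>v (C *\<^sub>v z) \<in> carrier_vec a" using G C z by auto
  have "0 = (C *\<^sub>v z) \<bullet> (G *\<^sub>v (C *\<^sub>v z))"
    using zero by (simp only: ssq_def UT[symmetric] UX UY G_def)
  also have "\<dots> = z \<bullet> (C *\<^sub>v (G *\<^sub>v (C *\<^sub>v z)))"
    using transpose_vec_mult_scalar[OF C GCz z] by (simp only: symC)
  also have "C *\<^sub>v (G *\<^sub>v (C *\<^sub>v z)) = C * G * C *\<^sub>v z"
    using G(1) C z assoc_mult_mat_vec[of "C * G" a a C a z] by (simp del: assoc_mult_mat)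
  also have "\<dots> = U\<^sup>T *\<^sub>v (U *\<^sub>v z)"
    using U z by (simp only: G(2)) (simp add: C_def)
  also have "z \<bullet> \<dots> = (U *\<^sub>v z) \<bullet> (U *\<^sub>v z)"
    using U z transpose_vec_mult_scalar[OF U z, of "U *\<^sub>v z"] comm_scalar_prod[of z a "U\<^sup>T *\<^sub>v (U *\<^sub>v z)"] by simp
  finally have "U *\<^sub>v z = 0\<^sub>v n"
    using U z real_scalar_prod_self_eq_0[of "U *\<^sub>v z" n] by simp
  moreover have "U\<^sup>T *\<^sub>v 0\<^sub>v n = 0\<^sub>v a" using U by (intro eq_vecI) auto
  ultimately have "C *\<^sub>v z = 0\<^sub>v a" using U z by (simp add: C_def)
  then show ?thesis using UY by (simp only: UT)
qed

lemma col_projection_props: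
  assumes M: "M \<in> carrier_mat n k"
  shows "col_projection M \<in> carrier_mat n n" "(col_projection M)\<^sup>T = col_projection M"
    "col_projection M * M = M" "col_projection M * col_projection M = col_projection M"
proof -
  obtain K where K: "K \<in> carrier_mat k n" "col_projection M = M * K"
    "(M * K)\<^sup>T = M * K" "M * K * M = M"
    using col_projectionE[OF M] .
  show P: "col_projection M \<in> carrier_mat n n" "(col_projection M)\<^sup>T = col_projection M"
    "col_projection M * M = M"
    using K M by auto
  have "M * K * (M * K) = M * K * M * K"
    using assoc_mult_mat[of "M * K" n n M k K n] M K(1) by auto
  then show "col_projection M * col_projection M = col_projection M"
    by (simp only: K)
qed

text \<open>The projection has the form \<open>L * K\<close>, so it factors through
  \<open>L\<close>.\<close>

lemma col_projection_absorb:
  assumes L: "L \<in> carrier_mat n l" and A: "A \<in> carrier_mat a n" and B: "B \<in> carrier_mat a n"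
    and eq: "A * L = B * L"
  shows "A * col_projection L = B * col_projection L"
proof -
  obtain K where K: "K \<in> carrier_mat l n" "col_projection L = L * K"
    using col_projectionE[OF L] .
  have "A * (L * K) = A * L * K" using A L K(1) by simp
  also have "\<dots> = B * (L * K)" unfolding eq using B L K(1) by simp
  finally show ?thesis by (simp only: K(2))
qed

lemma residual_props:
  fixes P :: "real mat"
  assumes P: "P \<in> carrier_mat n n" and sym: "P\<^sup>T = P" and idem: "P * P = P"
  shows "1\<^sub>m n - P \<in> carrier_mat n n" "(1\<^sub>m n - P)\<^sup>T = 1\<^sub>m n - P" "(1\<^sub>m n - P) * (1\<^sub>m n - P) = 1\<^sub>m n - P"
proof -
  show E: "1\<^sub>m n - P \<in> carrier_mat n n" using P by auto
  show "(1\<^sub>m n - P)\<^sup>T = 1\<^sub>m n - P"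
    using P sym by (subst transpose_minus[of _ n n]) auto
  have "P * (1\<^sub>m n - P) = 0\<^sub>m n n"
    using P idem by (simp add: mult_minus_distrib_mat[of _ n n _ n])
  moreover have "(1\<^sub>m n - P) * (1\<^sub>m n - P) = 1\<^sub>m n * (1\<^sub>m n - P) - P * (1\<^sub>m n - P)"
    by (rule minus_mult_distrib_mat) (use P E in auto)
  ultimately show "(1\<^sub>m n - P) * (1\<^sub>m n - P) = 1\<^sub>m n - P"
    unfolding left_mult_one_mat[OF E] using E P by (intro eq_matI) auto
qed

text \<open>The hypothesis \<open>sub\<close> says that the columns of \<open>L\<close> lie in the
  column space of \<open>M\<close>. Forwards, the form is tested at the columns of \<open>M\<close>,
  where its first version vanishes. Backwards, the equation extends from \<open>M\<close> to its
  projection, and nesting then gives \<open>X\<^sup>T * P = X\<^sup>T * S\<close>.\<close>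

lemma ssq_eq_iff:
  assumes X: "X \<in> carrier_mat n a" and M: "M \<in> carrier_mat n k" and L: "L \<in> carrier_mat n l"
    and sub: "col_projection M * L = L"
  shows "(\<forall>Y\<in>carrier_vec n. ssq X (1\<^sub>m n - col_projection M) Y = ssq X (1\<^sub>m n - col_projection L) Y)
    \<longleftrightarrow> X\<^sup>T * M = X\<^sup>T * col_projection L * M"
proof -
  define P where "P = col_projection M"
  define S where "S = col_projection L"
  note Pp = col_projection_props[OF M, folded P_def]
  note Sp = col_projection_props[OF L, folded S_def]
  note ES = residual_props[OF Sp(1,2,4)]
  have XT: "X\<^sup>T \<in> carrier_mat a n" using X by simp
  have res: "X\<^sup>T * (1\<^sub>m n - A) = X\<^sup>T - X\<^sup>T * A" if "A \<in> carrier_mat n n" for A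
    using mult_minus_distrib_mat[OF XT one_carrier_mat that] right_mult_one_mat[OF XT] by simp
  have resv: "X\<^sup>T * (1\<^sub>m n - A) *\<^sub>v v = X\<^sup>T *\<^sub>v v - X\<^sup>T * A *\<^sub>v v"
    if "A \<in> carrier_mat n n" "v \<in> carrier_vec n" for A v
    using XT that minus_mult_distrib_mat_vec[of "X\<^sup>T" a n "X\<^sup>T * A" v] by (simp only: res mult_carrier_mat)
  have PS: "P * S = S"
    using col_projection_absorb[OF L Pp(1), of "1\<^sub>m n"] sub L Sp(1) by (simp add: P_def S_def)
  \<comment> \<open>For nested column spaces the projections commute; this is the transpose of
    \<open>PS\<close>.\<close>
  have SP: "S * P = S"
    using transpose_mult[OF Pp(1) Sp(1)] by (simp add: PS Pp(2) Sp(2))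
  show ?thesis
    unfolding P_def[symmetric] S_def[symmetric]
  proof
    assume eq: "\<forall>Y\<in>carrier_vec n. ssq X (1\<^sub>m n - P) Y = ssq X (1\<^sub>m n - S) Y"
    have "X\<^sup>T *\<^sub>v v = X\<^sup>T * S *\<^sub>v v" if v: "v \<in> set (cols M)" for v
    proof -
      have v': "v \<in> carrier_vec n" using v M cols_dim[of M] by auto
      have "P *\<^sub>v v = v"
        using mat_eq_iff_cols[OF Pp(1) one_carrier_mat M] Pp(3) M v v' by simp
      then have "X\<^sup>T * (1\<^sub>m n - P) *\<^sub>v v = 0\<^sub>v a"
        using resv[OF Pp(1) v'] XT Pp(1) v' by simp
      \<comment> \<open>The vector entering the form is zero; \<open>is_ginverse_ginverse\<close>
        supplies the dimensions needed to evaluate it there.\<close>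
      then have "ssq X (1\<^sub>m n - P) v = 0"
        using is_ginverse_ginverse[of "X\<^sup>T * (1\<^sub>m n - P) * X"] X Pp(1)
        by (auto simp: ssq_def is_ginverse_def simp del: assoc_mult_mat assoc_mult_mat_vec)
      then have "ssq X (1\<^sub>m n - S) v = 0" using eq v' by simp
      then have "X\<^sup>T *\<^sub>v v - X\<^sup>T * S *\<^sub>v v = 0\<^sub>v a"
        using ssq_eq_0_imp[OF X ES(1) v' ES(2,3)] resv[OF Sp(1) v'] by simp
      then show ?thesis
        using XT Sp(1) v'
        by (intro eq_vecI) (auto simp: vec_eq_iff simp del: index_mult_mat_vec assoc_mult_mat_vec)
    qed
    then show "X\<^sup>T * M = X\<^sup>T * S * M"
      using mat_eq_iff_cols[of "X\<^sup>T" a n "X\<^sup>T * S" M k] XT Sp(1) M by auto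
  next
    assume "X\<^sup>T * M = X\<^sup>T * S * M"
    then have "X\<^sup>T * P = X\<^sup>T * S * P"
      unfolding P_def by (intro col_projection_absorb[OF M XT]) (use XT Sp(1) in auto)
    also have "\<dots> = X\<^sup>T * S" using XT Sp(1) Pp(1) SP by simp
    finally show "\<forall>Y\<in>carrier_vec n. ssq X (1\<^sub>m n - P) Y = ssq X (1\<^sub>m n - S) Y"
      by (simp add: ssq_def res[OF Pp(1)] res[OF Sp(1)])
  qed
qed

section \<open>Design matrices and adjustment for sets of factors\<close>

lemma design_mat_dim_row [simp]: "dim_row (design_mat D i) = nruns D"
  by (simp add: design_mat_def)

lemma design_mat_carrier [simp]: "design_mat D i \<in> carrier_mat (nruns D) (dim_col (design_mat D i))"
  by (rule carrier_matI) simp_all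

lemma juxtaposed_carrier: "juxtaposed D T \<in> carrier_mat (nruns D) (dim_col (juxtaposed D T))"
  unfolding juxtaposed_def by (rule carrier_matI) (rule mat_of_cols_carrier(2), rule refl)

text \<open>Conditions tested column by column see only this set, so the order of juxtaposition
  drops out.\<close>

lemma set_cols_juxtaposed:
  assumes "finite T"
  shows "set (cols (juxtaposed D T)) = (\<Union>t\<in>T. set (cols (design_mat D t)))"
proof -
  have "set (concat (map (\<lambda>t. cols (design_mat D t)) (sorted_list_of_set T))) \<subseteq> carrier_vec (nruns D)"
  proof
    fix v assume "v \<in> set (concat (map (\<lambda>t. cols (design_mat D t)) (sorted_list_of_set T)))"
    then obtain t where "v \<in> set (cols (design_mat D t))" by auto
    then have "v \<in> carrier_vec (dim_row (design_mat D t))" using cols_dim by blast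
    then show "v \<in> carrier_vec (nruns D)" by simp
  qed
  then show ?thesis
    unfolding juxtaposed_def using assms by (subst cols_mat_of_cols) auto
qed

lemma juxtaposed_singleton: "juxtaposed D {t} = design_mat D t"
  using mat_of_cols_cols[of "design_mat D t"]
  by (simp add: juxtaposed_def del: mat_of_cols_cols)

lemma mult_juxtaposed_eq_iff:
  assumes "finite T" "A \<in> carrier_mat a (nruns D)" "B \<in> carrier_mat a (nruns D)"
  shows "A * juxtaposed D T = B * juxtaposed D T \<longleftrightarrow>
    (\<forall>t\<in>T. A * design_mat D t = B * design_mat D t)"
  unfolding mat_eq_iff_cols[OF assms(2,3) juxtaposed_carrier]
    mat_eq_iff_cols[OF assms(2,3) design_mat_carrier] set_cols_juxtaposed[OF assms(1)]
  by blast

text \<open>The common reduction for both parts: since \<open>t\<close> is in \<open>T\<close>, the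
  column spaces are nested, and the matrix condition splits into one equation per factor in
  \<open>T\<close>.\<close>

lemma SS_eq_SS_singleton_iff:
  assumes T: "finite T" and t: "t \<in> T"
  shows "(\<forall>Y\<in>carrier_vec (nruns D). SS D i T Y = SS D i {t} Y) \<longleftrightarrow>
    (\<forall>j\<in>T. incidence D i j = (design_mat D i)\<^sup>T * col_projection (design_mat D t) * design_mat D j)"
proof -
  let ?n = "nruns D" and ?P = "col_projection (juxtaposed D T)"
  note Pp = col_projection_props[OF juxtaposed_carrier, of D T]
  have "\<forall>s\<in>T. ?P * design_mat D s = 1\<^sub>m ?n * design_mat D s"
    using mult_juxtaposed_eq_iff[OF T Pp(1) one_carrier_mat] Pp(3)
      left_mult_one_mat[OF juxtaposed_carrier] by simp
  then have sub: "?P * design_mat D t = design_mat D t"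
    using t left_mult_one_mat[OF design_mat_carrier] by simp
  have XT: "(design_mat D i)\<^sup>T \<in> carrier_mat (dim_col (design_mat D i)) ?n" by simp
  have XS: "(design_mat D i)\<^sup>T * col_projection (design_mat D t) \<in> carrier_mat (dim_col (design_mat D i)) ?n"
    using XT col_projection_props(1)[OF design_mat_carrier] by (rule mult_carrier_mat)
  show ?thesis
    unfolding SS_eq_ssq residual_mat_def juxtaposed_singleton incidence_def
      ssq_eq_iff[OF design_mat_carrier juxtaposed_carrier design_mat_carrier sub]
      mult_juxtaposed_eq_iff[OF T XT XS] ..
qed

section \<open>Projections for a single factor and for the general effect\<close>

text \<open>The matrix is diagonal because a run has only one level of a factor, and its diagonal
  entries are nonzero because every level occurs. This justifies taking \<open>the\<close> of the
  option value in the theorem.\<close>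

lemma mat_inverse_replication_mat:
  assumes plan: "blocked_main_effect_plan D" and i: "i \<in> {1..nfac D}"
  obtains B where "mat_inverse (replication_mat D i) = Some B"
proof -
  define N where "N = replication_mat D i"
  let ?l = "nlev D i" and ?n = "nruns D"
  have X: "design_mat D i = mat ?n ?l (\<lambda>(u, t). if lev D i u = t then 1 else 0)"
    using i by (auto simp: design_mat_def)
  have N: "N \<in> carrier_mat ?l ?l"
    unfolding N_def replication_mat_def incidence_def X
    by (rule mult_carrier_mat[of _ _ ?n]) simp_all
  have entry: "N $$ (p, q) = (\<Sum>u<?n. if lev D i u = p \<and> lev D i u = q then 1 else 0)"
    if "p < ?l" "q < ?l" for p q
    using that unfolding N_def replication_mat_def incidence_def X
    by (auto simp: scalar_prod_def atLeast0LessThan intro!: sum.cong)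
  have off: "N $$ (p, q) = 0" if "p < ?l" "q < ?l" "p \<noteq> q" for p q
    using that by (auto simp: entry intro!: sum.neutral)
  have pos: "N $$ (p, p) \<noteq> 0" if p: "p < ?l" for p
  proof -
    obtain u where "u < ?n" "lev D i u = p"
      using plan i p unfolding blocked_main_effect_plan_def by blast
    then have "0 < (\<Sum>u<?n. if lev D i u = p then 1 else (0 :: real))"
      by (intro sum_pos2[of _ u]) auto
    then show ?thesis using p by (simp add: entry)
  qed
  define B where "B = mat ?l ?l (\<lambda>(p, q). if p = q then 1 / N $$ (p, p) else 0)"
  have "N * B = 1\<^sub>m ?l"
  proof (rule eq_matI)
    fix p q assume "p < dim_row (1\<^sub>m ?l :: real mat)" "q < dim_col (1\<^sub>m ?l :: real mat)"
    then have pq: "p < ?l" "q < ?l" by auto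
    have "(N * B) $$ (p, q) = (\<Sum>s<?l. N $$ (p, s) * B $$ (s, q))"
      using pq N by (simp add: B_def scalar_prod_def atLeast0LessThan)
    also have "\<dots> = (\<Sum>s<?l. if s = q then N $$ (p, q) / N $$ (q, q) else 0)"
      using pq by (intro sum.cong) (auto simp: B_def)
    also have "\<dots> = 1\<^sub>m ?l $$ (p, q)"
      using pq pos off by simp
    finally show "(N * B) $$ (p, q) = 1\<^sub>m ?l $$ (p, q)" .
  qed (use N in \<open>auto simp: B_def\<close>)
  moreover have B: "B \<in> carrier_mat ?l ?l" by (simp add: B_def)
  moreover have "B * N = 1\<^sub>m ?l"
    using mat_mult_left_right_inverse[OF N B] \<open>N * B = 1\<^sub>m ?l\<close> by simp
  \<comment> \<open>\<open>mat_inverse\<close> returns \<open>None\<close> only for matrices outside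
    the units of this ring.\<close>
  ultimately have "N \<in> Units (ring_mat TYPE(real) ?l ())"
    using N by (auto simp: Units_def ring_mat_simps)
  then show ?thesis
    using mat_inverse(1)[OF N, of "()"] that by (cases "mat_inverse N") (auto simp: N_def)
qed

lemma col_projection_design_mat:
  assumes plan: "blocked_main_effect_plan D" and i: "i \<in> {1..nfac D}"
  shows "col_projection (design_mat D i) =
    design_mat D i * the (mat_inverse (replication_mat D i)) * (design_mat D i)\<^sup>T"
    and "the (mat_inverse (replication_mat D i)) \<in> carrier_mat (dim_col (design_mat D i)) (dim_col (design_mat D i))"
proof -
  let ?X = "design_mat D i"
  obtain B where some: "mat_inverse (replication_mat D i) = Some B"
    using mat_inverse_replication_mat[OF plan i] .
  have "replication_mat D i \<in> carrier_mat (dim_col ?X) (dim_col ?X)"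
    unfolding replication_mat_def incidence_def
    by (rule mult_carrier_mat[OF _ design_mat_carrier]) simp
  from mat_inverse(2)[OF this some]
  have B: "?X\<^sup>T * ?X * B = 1\<^sub>m (dim_col ?X)" "B * (?X\<^sup>T * ?X) = 1\<^sub>m (dim_col ?X)"
    "B \<in> carrier_mat (dim_col ?X) (dim_col ?X)"
    by (auto simp: replication_mat_def incidence_def)
  then show "col_projection ?X = ?X * the (mat_inverse (replication_mat D i)) * ?X\<^sup>T"
    and "the (mat_inverse (replication_mat D i)) \<in> carrier_mat (dim_col ?X) (dim_col ?X)"
    using col_projection_gram_inverse[OF design_mat_carrier B(3,1,2)] by (auto simp: some)
qed

lemma col_projection_ones:
  assumes "0 < n"
  shows "col_projection (mat n 1 (\<lambda>_. 1)) = (1 / real n) \<cdot>\<^sub>m (mat n 1 (\<lambda>_. 1) * (mat n 1 (\<lambda>_. 1))\<^sup>T)"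
proof -
  let ?J = "mat n 1 (\<lambda>_. 1) :: real mat"
  let ?B = "mat 1 1 (\<lambda>_. 1 / real n)"
  have "?J\<^sup>T * ?J * ?B = 1\<^sub>m 1" "?B * (?J\<^sup>T * ?J) = 1\<^sub>m 1"
    using assms by (auto simp: scalar_prod_def intro!: eq_matI)
  then have "col_projection ?J = ?J * ?B * ?J\<^sup>T"
    by (intro col_projection_gram_inverse) auto
  also have "\<dots> = (1 / real n) \<cdot>\<^sub>m (?J * ?J\<^sup>T)"
    by (intro eq_matI) (auto simp: scalar_prod_def)
  finally show ?thesis .
qed

text \<open>Each run has exactly one level of the factor, so the indicator columns sum to the
  all-one column.\<close>

lemma general_effect_mem_col_space:
  assumes plan: "blocked_main_effect_plan D" and i: "i \<in> {1..nfac D}"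
  shows "col_projection (design_mat D i) * mat (nruns D) 1 (\<lambda>_. 1) = mat (nruns D) 1 (\<lambda>_. 1)"
proof -
  let ?n = "nruns D" and ?X = "design_mat D i"
  define o1 where "o1 = (mat (nlev D i) 1 (\<lambda>_. 1) :: real mat)"
  have X: "?X = mat ?n (nlev D i) (\<lambda>(u, t). if lev D i u = t then 1 else 0)"
    using i by (auto simp: design_mat_def)
  have XC: "?X \<in> carrier_mat ?n (nlev D i)" by (simp add: X)
  have "\<forall>u<?n. lev D i u < nlev D i"
    using plan i by (auto simp: blocked_main_effect_plan_def)
  then have "mat ?n 1 (\<lambda>_. 1) = ?X * o1"
    unfolding X o1_def by (intro eq_matI) (auto simp: scalar_prod_def)
  moreover have "col_projection ?X * (?X * o1) = col_projection ?X * ?X * o1"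
    using assoc_mult_mat[OF col_projection_props(1)[OF XC] XC, of o1 1] by (simp add: o1_def)
  ultimately show ?thesis by (simp only: col_projection_props(3)[OF XC])
qed

section \<open>Specialisation to the general effect and to blocks\<close>

theorem theorem3p1:
  fixes D :: plan and n m :: nat
  assumes plan: "blocked_main_effect_plan D"
    and n: "n = nruns D"
    and m: "m = nfac D"
  shows
    "(\<forall>i\<in>{1..m}.
        (\<forall>Y\<in>carrier_vec n. SS_all D i Y = SS D i {m + 1} Y) \<longleftrightarrow>
        (\<forall>j\<in>{1..m} - {i}.
           incidence D i j = (1 / real n) \<cdot>\<^sub>m (replication D i * (replication D j)\<^sup>T)))
     \<and>
     (\<forall>i\<in>{1..m - 1}.
        (\<forall>Y\<in>carrier_vec n. SS_all D i Y = SS D i {m} Y) \<longleftrightarrow>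
        (\<forall>j\<in>{1..m - 1} - {i}.
           incidence D i j =
             incidence D i m * the (mat_inverse (replication_mat D m)) * (incidence D j m)\<^sup>T))"
proof -
  have n0: "0 < n" and m3: "3 \<le> m"
    using plan by (auto simp: blocked_main_effect_plan_def n m)
  define J where "J = (mat n 1 (\<lambda>_. 1) :: real mat)"
  have J: "J \<in> carrier_mat n 1" by (simp add: J_def)
  have JD: "design_mat D (m + 1) = J" by (simp add: design_mat_def J_def n m)
  define X where "X i = design_mat D i" for i
  define b where "b i = dim_col (X i)" for i
  have X: "X i \<in> carrier_mat n (b i)" for i by (simp add: X_def b_def n)
  have XT: "(X i)\<^sup>T \<in> carrier_mat (b i) n" for i using X[of i] by simp
  have inc: "incidence D i j = (X i)\<^sup>T * X j" for i j by (simp add: incidence_def X_def)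
  have fixed: "incidence D i t = (X i)\<^sup>T * col_projection (X t) * X t" for i t
    using assoc_mult_mat[OF XT col_projection_props(1)[OF X] X, of i t t]
    by (simp only: inc col_projection_props(3)[OF X])
  have SS_iff: "(\<forall>Y\<in>carrier_vec n. SS_all D i Y = SS D i {t} Y) \<longleftrightarrow>
      (\<forall>j\<in>{1..m + 1} - {i}. incidence D i j = (X i)\<^sup>T * col_projection (X t) * X j)"
    if "t \<in> {1..m + 1} - {i}" for i t
    unfolding SS_all_def m n X_def
    by (rule SS_eq_SS_singleton_iff) (use that in \<open>auto simp: m\<close>)

  have proportional: "(X i)\<^sup>T * col_projection (X (m + 1)) * X j
      = (1 / real n) \<cdot>\<^sub>m (replication D i * (replication D j)\<^sup>T)" for i j
  proof -
    have rep: "replication D k = (X k)\<^sup>T * J" for k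
      by (simp add: replication_def X_def J_def n)
    have JJ: "J * J\<^sup>T \<in> carrier_mat n n" and JT: "J\<^sup>T \<in> carrier_mat 1 n" using J by auto
    have "(X i)\<^sup>T * col_projection (X (m + 1)) * X j = (1 / real n) \<cdot>\<^sub>m ((X i)\<^sup>T * (J * J\<^sup>T) * X j)"
      unfolding X_def[of "m + 1"] JD unfolding J_def col_projection_ones[OF n0]
      unfolding J_def[symmetric] mult_smult_distrib[OF XT JJ]
      by (rule mult_smult_assoc_mat[OF mult_carrier_mat[OF XT JJ] X])
    also have "(X i)\<^sup>T * (J * J\<^sup>T) * X j = (X i)\<^sup>T * J * (J\<^sup>T * X j)"
      using assoc_mult_mat[OF XT J JT, of i] assoc_mult_mat[OF mult_carrier_mat[OF XT J] JT X, of i j] by simp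
    also have "J\<^sup>T * X j = ((X j)\<^sup>T * J)\<^sup>T"
      using transpose_mult[OF XT J] by simp
    finally show ?thesis by (simp only: rep)
  qed
  have "(\<forall>Y\<in>carrier_vec n. SS_all D i Y = SS D i {m + 1} Y) \<longleftrightarrow>
      (\<forall>j\<in>{1..m} - {i}. incidence D i j = (1 / real n) \<cdot>\<^sub>m (replication D i * (replication D j)\<^sup>T))"
    if i: "i \<in> {1..m}" for i
  proof -
    have others: "{1..m + 1} - {i} = insert (m + 1) ({1..m} - {i})" using i by auto
    have "m + 1 \<in> {1..m + 1} - {i}" using i by auto
    from SS_iff[OF this] show ?thesis
      unfolding others proportional[symmetric] using fixed[of i "m + 1"] by blast
  qed
  moreover
  define B where "B = the (mat_inverse (replication_mat D m))"
  have mm: "m \<in> {1..nfac D}" using m3 m by auto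
  have Pm: "col_projection (X m) = X m * B * (X m)\<^sup>T" and B: "B \<in> carrier_mat (b m) (b m)"
    using col_projection_design_mat[OF plan, of m] mm by (simp_all add: X_def B_def b_def)
  have within_blocks: "(X i)\<^sup>T * col_projection (X m) * X j
      = incidence D i m * B * (incidence D j m)\<^sup>T" for i j
  proof -
    have XmB: "X m * B \<in> carrier_mat n (b m)" using X B by (rule mult_carrier_mat)
    have "(incidence D j m)\<^sup>T = (X m)\<^sup>T * X j"
      using transpose_mult[OF XT X, of j m] by (simp add: inc)
    moreover have "(X i)\<^sup>T * X m * B = (X i)\<^sup>T * (X m * B)"
      using assoc_mult_mat[OF XT X B] .
    moreover have "(X i)\<^sup>T * (X m * B) * ((X m)\<^sup>T * X j) = (X i)\<^sup>T * (X m * B) * (X m)\<^sup>T * X j"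
      using assoc_mult_mat[OF mult_carrier_mat[OF XT XmB] XT X] by simp
    moreover have "(X i)\<^sup>T * (X m * B) * (X m)\<^sup>T = (X i)\<^sup>T * (X m * B * (X m)\<^sup>T)"
      using assoc_mult_mat[OF XT XmB XT] .
    ultimately show ?thesis by (simp only: inc Pm)
  qed
  have general: "incidence D i (m + 1) = (X i)\<^sup>T * col_projection (X m) * X (m + 1)" for i
  proof -
    have "col_projection (X m) * X (m + 1) = X (m + 1)"
      using general_effect_mem_col_space[OF plan mm] by (simp only: X_def JD J_def n)
    then show ?thesis
      using assoc_mult_mat[OF XT col_projection_props(1)[OF X] X, of i m "m + 1"] by (simp only: inc)
  qed
  have "(\<forall>Y\<in>carrier_vec n. SS_all D i Y = SS D i {m} Y) \<longleftrightarrow>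
      (\<forall>j\<in>{1..m - 1} - {i}. incidence D i j = incidence D i m * B * (incidence D j m)\<^sup>T)"
    if i: "i \<in> {1..m - 1}" for i
  proof -
    \<comment> \<open>As \<open>i\<close> is not the block factor, \<open>m\<close> is among the
      adjusting factors. Its equation is an instance of \<open>fixed\<close>, and that of
      \<open>m + 1\<close> is \<open>general\<close>; the remaining indices are those of the stated
      condition.\<close>
    have others: "{1..m + 1} - {i} = insert (m + 1) (insert m ({1..m - 1} - {i}))" using i by auto
    have "m \<in> {1..m + 1} - {i}" using i by auto
    from SS_iff[OF this] show ?thesis
      unfolding others within_blocks[symmetric] using fixed[of i m] general[of i] by blast
  qed
  ultimately show ?thesis by (simp only: B_def) blast
qed

end
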